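(* Let $p\ge 2$ and suppose $z(t)\in L^p(\Omega,\mathbb P)$ for every $t\in[0,T]$ and $\int_0^T \mathbb E[|z(t)|^p]^{2/p}\,dt<+\infty$. Let $F:[0,T]\times\mathbb R\to\mathbb R$ satisfy: (i) $F(t,\xi)\ge 0$ for all $(t,\xi)$; (ii) $F(t,\xi)$ is twice continuously differentiable in $\xi$ and $\frac{\partial F}{\partial \xi}$, $\frac{\partial^2 F}{\partial \xi^2}$ are continuous functions of both variables; (iii) there exist $\alpha\in(0,p)$ and a non-negative $L\in L^1(0,T)$ such that $|F(t,\xi)|+\left|\frac{\partial F}{\partial \xi}(t,\xi)\right|+\left|\frac{\partial^2 F}{\partial \xi^2}(t,\xi)\right|\le L(t)(1+|\xi|^\alpha)$ for all $t\in[0,T]$, $\xi\in\mathbb R$; (iv) for every fixed $t\in[0,T]$ the function $\xi\mapsto F(t,\xi)$ is convex. Let $\overline u\in L^1(0,T)$ satisfy $$\int_{t_0}^T \mathbb E\left[\frac{\partial F}{\partial \xi}(t,\xi_{\overline u}(t))\,\frac{G(t)}{G(t_0)}\,e^{A(t)-A(t_0)}\right]dt=0\qquad\text{for all } t_0\in[0,T].$$ Then $\overline u$ is a global minimizer of $J$ over $L^1(0,T)$.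
   Context: Fix $T>0$, a filtered probability space $(\Omega,\mathcal F,(\mathcal F_t)_{t\ge 0},\mathbb P)$ and an $\mathcal F_t$-Brownian motion $W$ (started at $0$). $a:[0,T]\to\mathbb R$ is a deterministic function in $L^\infty(0,T)$, $A(t)=\int_0^t a(s)\,ds$, $G(t)=e^{W(t)-t/2}$. $z$ is a real $\mathcal F_t$-adapted, jointly measurable process; $F$ is Borel measurable. $L^1(0,T)$ denotes deterministic integrable real functions. For $u\in L^1(0,T)$ put $$\xi_u(t)=G(t)e^{A(t)}\int_0^t\frac{e^{-A(s)}}{G(s)}(z(s)-u(s))\,ds,$$ i.e. the solution of $d\xi=[a(t)\xi+z(t)-u(t)]dt+\xi\,dW(t)$, $\xi(0)=0$, and define $J[u]=\mathbb E\left[\int_0^T F(t,\xi_u(t))\,dt\right]$. *)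

theory Defs
  imports "HOL-Probability.Probability"
begin

(* The time index is a nonnegative real; values of Ft and W at negative times are never used.
   In particular Ft is only required to be a filtration on {0..}, which is why the library locale
   filtration (indexed by a whole type) is not used. *)
locale filtered_prob_space = prob_space M for M :: "'a measure" +
  fixes Ft :: "real \<Rightarrow> 'a measure"
  assumes Ft_subalgebra: "0 \<le> t \<Longrightarrow> subalgebra M (Ft t)"
    and Ft_mono: "0 \<le> s \<Longrightarrow> s \<le> t \<Longrightarrow> subalgebra (Ft t) (Ft s)"

(* Convention: a Brownian motion is a continuous process, i.e. every path is continuous; no
   completeness of M or Ft is required. The second parameter of normal_density is the standard
   deviation. *)
locale brownian_motion = filtered_prob_space M Ft
  for M :: "'a measure" and Ft :: "real \<Rightarrow> 'a measure" +
  fixes W :: "real \<Rightarrow> 'a \<Rightarrow> real"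
  assumes W_adapted: "0 \<le> t \<Longrightarrow> W t \<in> borel_measurable (Ft t)"
    and W_zero: "AE \<omega> in M. W 0 \<omega> = 0"
    and W_continuous: "\<omega> \<in> space M \<Longrightarrow> continuous_on {0..} (\<lambda>t. W t \<omega>)"
    and W_increment_normal: "0 \<le> s \<Longrightarrow> s < t \<Longrightarrow>
      distributed M lborel (\<lambda>\<omega>. W t \<omega> - W s \<omega>) (normal_density 0 (sqrt (t - s)))"
    and W_increment_indep: "0 \<le> s \<Longrightarrow> s < t \<Longrightarrow>
      indep_set (sets (vimage_algebra (space M) (\<lambda>\<omega>. W t \<omega> - W s \<omega>) borel)) (sets (Ft s))"

(* Representatives, rather than classes modulo null sets, of elements of L^1(0,T) and
   L^infinity(0,T). *)
definition L1 :: "real \<Rightarrow> (real \<Rightarrow> real) set" where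
  "L1 T = {u. u absolutely_integrable_on {0..T}}"

definition Linf :: "real \<Rightarrow> (real \<Rightarrow> real) set" where
  "Linf T = {a \<in> borel_measurable (lebesgue_on {0..T}).
     \<exists>C. AE t in lebesgue_on {0..T}. \<bar>a t\<bar> \<le> C}"

definition prim :: "(real \<Rightarrow> real) \<Rightarrow> real \<Rightarrow> real" where
  "prim a t = (LINT s:{0..t}|lebesgue. a s)"

definition geom_bm :: "(real \<Rightarrow> 'a \<Rightarrow> real) \<Rightarrow> real \<Rightarrow> 'a \<Rightarrow> real" where
  "geom_bm W t \<omega> = exp (W t \<omega> - t / 2)"

(* The explicit solution of d xi = [a(t) xi + z(t) - u(t)] dt + xi dW(t), xi(0) = 0. *)
definition state ::
  "(real \<Rightarrow> 'a \<Rightarrow> real) \<Rightarrow> (real \<Rightarrow> real) \<Rightarrow> (real \<Rightarrow> 'a \<Rightarrow> real) \<Rightarrow> (real \<Rightarrow> real) \<Rightarrow> real \<Rightarrow> 'a \<Rightarrow> real"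
where
  "state W a z u t \<omega> = geom_bm W t \<omega> * exp (prim a t) *
     (LINT s:{0..t}|lebesgue. exp (- prim a s) / geom_bm W s \<omega> * (z s \<omega> - u s))"

(* J[u] as an element of [0, infinity]. The coercion ennreal sends negative reals to 0, so this is
   the intended cost only for F \<ge> 0. *)
definition cost ::
  "'a measure \<Rightarrow> (real \<Rightarrow> 'a \<Rightarrow> real) \<Rightarrow> (real \<Rightarrow> real) \<Rightarrow> (real \<Rightarrow> 'a \<Rightarrow> real) \<Rightarrow> real
    \<Rightarrow> (real \<Rightarrow> real \<Rightarrow> real) \<Rightarrow> (real \<Rightarrow> real) \<Rightarrow> ennreal"
where
  "cost M W a z T F u =
     (\<integral>\<^sup>+\<omega>. (\<integral>\<^sup>+t\<in>{0..T}. ennreal (F t (state W a z u t \<omega>)) \<partial>lebesgue) \<partial>M)"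

end

theory Submission
  imports Defs
begin

text \<open>
  The state is an affine function of the control: with the propagator
  \<open>\<Phi>(s, t) = G(t) / G(s) * exp (A(t) - A(s))\<close> one has
  \<open>\<xi>_u(t) = \<integral>\<^sub>0\<^sup>t \<Phi>(s, t) (z(s) - u(s)) ds\<close>. Since \<open>F(t, \<cdot>)\<close> lies above its tangents,
  \[ F(t, \xi_u) \ge F(t, \xi_{\bar u}) + \partial_\xi F(t, \xi_{\bar u}) (\xi_u - \xi_{\bar u}), \]
  and it remains to see that the last term has integral \<open>0\<close> over time and probability. Exchanging
  the order of integration (lemma \<open>adjoint_duality\<close>) turns that integral into
  \[ \int_0^T (\bar u(s) - u(s)) \int_s^T E [\partial_\xi F(t, \xi_{\bar u}(t)) \Phi(s, t)] dt ds, \]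
  whose inner integral vanishes for every \<open>s\<close> by stationarity.

  The analytic work lies in justifying the exchange, that is, in bounding
  \<open>E [|\<xi>(t)|\<^sup>\<alpha> \<Phi>(s, t)]\<close> uniformly in \<open>s \<le> t\<close>. The propagator is log-normal up to a bounded
  factor, so all its moments are bounded (\<open>flow_moment\<close>). Choose \<open>q\<close> with \<open>max \<alpha> 1 < q < p\<close>. Because
  \<open>q < p\<close>, the \<open>q\<close>-th moment of a product \<open>\<Phi>(s, t) z(s)\<close> is controlled by the \<open>p\<close>-th moment of
  \<open>z(s)\<close> and a higher moment of \<open>\<Phi>\<close>; integrating over \<open>s\<close> by Jensen's inequality for a suitable
  weight bounds \<open>E |\<xi>(t)|\<^sup>q\<close> uniformly in \<open>t\<close> (\<open>state_moment\<close>). As \<open>\<alpha> < q\<close>, the same splitting of a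
  product into two powers bounds \<open>|\<xi>|\<^sup>\<alpha> \<Phi>\<close> by \<open>|\<xi>|\<^sup>q\<close> plus a power of \<open>\<Phi>\<close>
  (\<open>integrable_adjoint_kernel\<close>).
\<close>

section \<open>Inequalities for powers, and exponential moments of a normal variable\<close>

text \<open>
  A version of Young's inequality without the optimal constants: the exponents \<open>q / \<alpha>\<close> and
  \<open>q / (q - \<alpha>)\<close> are conjugate, and the first or the second summand alone suffices according to
  whether \<open>y\<close> is smaller or larger than \<open>x powr (q - \<alpha>)\<close>. It splits the expectation of a product
  into moments of its factors.
\<close>

lemma powr_mult_le_add_powr:
  fixes x y \<alpha> q :: real
  assumes "0 \<le> x" "0 \<le> y" "0 \<le> \<alpha>" "\<alpha> < q"
  shows "x powr \<alpha> * y \<le> x powr q + y powr (q / (q - \<alpha>))"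
proof (cases "y \<le> x powr (q - \<alpha>)")
  case True
  then have "x powr \<alpha> * y \<le> x powr \<alpha> * x powr (q - \<alpha>)"
    by (intro mult_left_mono) auto
  also have "\<dots> = x powr q"
    using assms by (simp flip: powr_add)
  finally show ?thesis
    by (smt (verit) powr_ge_zero)
next
  case False
  then have y: "y > 0" and less: "x powr (q - \<alpha>) \<le> y"
    by (smt (verit) powr_ge_zero)+
  have "x powr \<alpha> = (x powr (q - \<alpha>)) powr (\<alpha> / (q - \<alpha>))"
    using assms by (simp add: powr_powr)
  also have "\<dots> \<le> y powr (\<alpha> / (q - \<alpha>))"
    using assms less by (intro powr_mono2) auto
  finally have "x powr \<alpha> * y \<le> y powr (\<alpha> / (q - \<alpha>)) * y powr 1"
    using y by (intro mult_mono) auto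
  also have "\<dots> = y powr (q / (q - \<alpha>))"
  proof -
    have "\<alpha> / (q - \<alpha>) + 1 = q / (q - \<alpha>)"
      using assms by (simp add: field_simps)
    then show ?thesis by (metis powr_add)
  qed
  finally show ?thesis
    by (smt (verit) powr_ge_zero)
qed

lemma powr_above_tangent:
  fixes x m q :: real
  assumes "0 \<le> x" "0 < m" "1 \<le> q"
  shows "m powr q + q * m powr (q - 1) * (x - m) \<le> x powr q"
proof (cases "x = 0")
  case True
  have "m powr q = m powr (q - 1) * m"
    using assms by (simp add: powr_diff)
  then show ?thesis
    using True assms by (auto simp: algebra_simps intro: mult_right_mono[of 1 q "m powr q", simplified])
next
  case False
  then have "x powr q - m powr q \<ge> (q * m powr (q - 1)) * (x - m)"
    using assms
    by (intro convex_on_imp_above_tangent[OF powr_convex])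
       (auto intro!: derivative_eq_intros simp: interior_open powr_diff)
  then show ?thesis by simp
qed

lemma ennreal_integral_le_nn_integral:
  fixes g :: "'b \<Rightarrow> real"
  assumes "integrable N g"
  shows "ennreal (integral\<^sup>L N g) \<le> (\<integral>\<^sup>+ s. ennreal (g s) \<partial>N)"
proof -
  have "integral\<^sup>L N g \<le> (\<integral>s. max 0 (g s) \<partial>N)"
    using assms by (intro integral_mono) auto
  then have "ennreal (integral\<^sup>L N g) \<le> ennreal (\<integral>s. max 0 (g s) \<partial>N)"
    by (rule ennreal_leI)
  also have "\<dots> = (\<integral>\<^sup>+ s. ennreal (max 0 (g s)) \<partial>N)"
    using assms by (intro nn_integral_eq_integral[symmetric]) auto
  also have "\<dots> = (\<integral>\<^sup>+ s. ennreal (g s) \<partial>N)"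
    by (simp add: max_def ennreal_neg cong: if_cong) (auto intro!: nn_integral_cong simp: ennreal_neg)
  finally show ?thesis .
qed

text \<open>
  Jensen's inequality for the probability measure with density \<open>h / H\<close>, where \<open>H\<close> is the integral
  of \<open>h\<close>, and the function \<open>|f| / h\<close>. It follows by integrating the tangent of \<open>x \<mapsto> x powr q\<close>
  at the mean \<open>m = \<integral>|f| / H\<close>. If \<open>f\<close> is not integrable, its integral is \<open>0\<close> by convention and the
  inequality still holds, so it applies pathwise without excluding a null set.
  It serves as a substitute for Minkowski's integral inequality.
\<close>

lemma weighted_jensen_powr:
  fixes f h :: "'b \<Rightarrow> real"
  assumes h: "integrable N h" "\<And>s. s \<in> space N \<Longrightarrow> 0 < h s" and q: "1 \<le> q"
  shows "ennreal (\<bar>\<integral>s. f s \<partial>N\<bar> powr q)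
    \<le> ennreal ((\<integral>s. h s \<partial>N) powr (q - 1)) * (\<integral>\<^sup>+ s. ennreal (h s * (\<bar>f s\<bar> / h s) powr q) \<partial>N)"
proof -
  define I H where "I = (\<integral>s. \<bar>f s\<bar> \<partial>N)" and "H = (\<integral>s. h s \<partial>N)"
  have I_ge: "\<bar>\<integral>s. f s \<partial>N\<bar> \<le> I"
    unfolding I_def by (rule integral_abs_bound)
  show ?thesis
  proof (cases "I = 0 \<or> \<not> integrable N f")
    case True
    then have "(\<integral>s. f s \<partial>N) = 0"
      using I_ge by (auto simp: not_integrable_integral_eq)
    then show ?thesis by simp
  next
    case False
    then have f[measurable]: "integrable N f" and "I > 0"
      using I_ge by auto
    have "H \<ge> 0"
      unfolding H_def using h by (intro integral_nonneg_AE AE_I2) (auto simp: less_imp_le)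
    moreover have "H \<noteq> 0"
    proof
      assume "H = 0"
      then have "AE s in N. h s = 0"
        unfolding H_def
        using h by (subst (asm) integral_nonneg_eq_0_iff_AE) (auto simp: less_imp_le)
      then have "AE s in N. f s = 0"
        using AE_space by eventually_elim (use h in force)
      then have "I = (\<integral>s. 0 \<partial>N)"
        unfolding I_def using f by (intro integral_cong_AE) auto
      with \<open>I > 0\<close> show False by simp
    qed
    ultimately have "H > 0" by simp
    \<comment> \<open>The point of tangency: the mean of \<open>|f| / h\<close> with respect to the weight \<open>h\<close>.\<close>
    define m where "m = I / H"
    have "m > 0" and mH: "m * H = I"
      using \<open>I > 0\<close> \<open>H > 0\<close> by (auto simp: m_def)
    \<comment> \<open>The tangent at \<open>m\<close>, evaluated at \<open>|f| / h\<close> and multiplied by the weight.\<close>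
    define g where "g s = (m powr q - q * m powr (q - 1) * m) * h s + q * m powr (q - 1) * \<bar>f s\<bar>" for s
    have g: "integrable N g"
      unfolding g_def using h f by auto
    have "integral\<^sup>L N g = (m powr q - q * m powr (q - 1) * m) * H + q * m powr (q - 1) * I"
      unfolding g_def H_def I_def using h f by simp
    also have "\<dots> = m powr q * H"
      by (simp add: mH[symmetric] algebra_simps)
    finally have int_g: "integral\<^sup>L N g = m powr q * H" .
    have g_le: "g s \<le> h s * (\<bar>f s\<bar> / h s) powr q" if "s \<in> space N" for s
    proof -
      have "g s = h s * (m powr q + q * m powr (q - 1) * (\<bar>f s\<bar> / h s - m))"
        using h(2)[OF that] by (simp add: g_def field_simps)
      also have "\<dots> \<le> h s * (\<bar>f s\<bar> / h s) powr q"
        using h(2)[OF that] \<open>m > 0\<close> q by (intro mult_left_mono powr_above_tangent) auto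
      finally show ?thesis .
    qed
    have "I powr q = H powr (q - 1) * (m powr q * H)"
      using \<open>m > 0\<close> \<open>H > 0\<close> by (simp add: mH[symmetric] powr_mult powr_diff)
    then have "\<bar>\<integral>s. f s \<partial>N\<bar> powr q \<le> H powr (q - 1) * (m powr q * H)"
      using I_ge q by (metis abs_ge_zero powr_mono2 order.trans zero_le_one)
    then have "ennreal (\<bar>\<integral>s. f s \<partial>N\<bar> powr q) \<le> ennreal (H powr (q - 1)) * ennreal (integral\<^sup>L N g)"
      using \<open>H > 0\<close> by (simp add: int_g flip: ennreal_mult)
    also have "\<dots> \<le> ennreal (H powr (q - 1)) * (\<integral>\<^sup>+ s. ennreal (h s * (\<bar>f s\<bar> / h s) powr q) \<partial>N)"
      by (intro mult_left_mono order.trans[OF ennreal_integral_le_nn_integral[OF g]] nn_integral_mono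
          ennreal_leI g_le) auto
    finally show ?thesis by (simp add: H_def)
  qed
qed

text \<open>
  Completing the square turns \<open>exp (r * x)\<close> times the centred density into a constant multiple of
  the normal density with mean \<open>r * \<sigma>\<^sup>2\<close>.
\<close>

lemma (in prob_space) nn_integral_exp_normal:
  assumes X: "distributed M lborel X (normal_density 0 \<sigma>)" and \<sigma>: "\<sigma> > 0"
  shows "(\<integral>\<^sup>+ \<omega>. ennreal (exp (r * X \<omega>)) \<partial>M) = ennreal (exp (r\<^sup>2 * \<sigma>\<^sup>2 / 2))"
proof -
  have "(\<integral>\<^sup>+ \<omega>. ennreal (exp (r * X \<omega>)) \<partial>M)
      = (\<integral>\<^sup>+ x. ennreal (normal_density 0 \<sigma> x) * ennreal (exp (r * x)) \<partial>lborel)"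
    by (rule distributed_nn_integral[OF X, symmetric]) simp
  also have "\<dots> = (\<integral>\<^sup>+ x. ennreal (exp (r\<^sup>2 * \<sigma>\<^sup>2 / 2)) * ennreal (normal_density (r * \<sigma>\<^sup>2) \<sigma> x) \<partial>lborel)"
  proof (intro nn_integral_cong)
    fix x
    have "- x\<^sup>2 / (2 * \<sigma>\<^sup>2) + r * x = r\<^sup>2 * \<sigma>\<^sup>2 / 2 - (x - r * \<sigma>\<^sup>2)\<^sup>2 / (2 * \<sigma>\<^sup>2)"
      using \<sigma> by (simp add: field_simps power2_eq_square)
    then have "exp (- x\<^sup>2 / (2 * \<sigma>\<^sup>2)) * exp (r * x)
        = exp (r\<^sup>2 * \<sigma>\<^sup>2 / 2) * exp (- (x - r * \<sigma>\<^sup>2)\<^sup>2 / (2 * \<sigma>\<^sup>2))"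
      by (simp flip: exp_add)
    then have "normal_density 0 \<sigma> x * exp (r * x) = exp (r\<^sup>2 * \<sigma>\<^sup>2 / 2) * normal_density (r * \<sigma>\<^sup>2) \<sigma> x"
      by (simp add: normal_density_def)
    then show "ennreal (normal_density 0 \<sigma> x) * ennreal (exp (r * x))
        = ennreal (exp (r\<^sup>2 * \<sigma>\<^sup>2 / 2)) * ennreal (normal_density (r * \<sigma>\<^sup>2) \<sigma> x)"
      by (simp flip: ennreal_mult)
  qed
  also have "\<dots> = ennreal (exp (r\<^sup>2 * \<sigma>\<^sup>2 / 2)) * (\<integral>\<^sup>+ x. ennreal (normal_density (r * \<sigma>\<^sup>2) \<sigma> x) \<partial>lborel)"
    by (rule nn_integral_cmult) auto
  also have "(\<integral>\<^sup>+ x. ennreal (normal_density (r * \<sigma>\<^sup>2) \<sigma> x) \<partial>lborel) = 1"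
    using prob_space.emeasure_space_1[OF prob_space_normal_density[OF \<sigma>, of "r * \<sigma>\<^sup>2"]]
    by (simp add: emeasure_density)
  finally show ?thesis by simp
qed

section \<open>Integrals over the time interval\<close>

lemma (in pair_sigma_finite) AE_pair_snd:
  assumes "AE y in M2. P y"
  shows "AE x in M1 \<Otimes>\<^sub>M M2. P (snd x)"
proof -
  obtain N where N: "{y \<in> space M2. \<not> P y} \<subseteq> N" "emeasure M2 N = 0" "N \<in> sets M2"
    using assms by (rule AE_E)
  have "space M1 \<times> N \<in> null_sets (M1 \<Otimes>\<^sub>M M2)"
    using N by (intro null_setsI) (auto simp: M2.emeasure_pair_measure_Times)
  then show ?thesis
    by (rule AE_I') (use N in \<open>auto simp: space_pair_measure\<close>)
qed

lemma set_lebesgue_integral_initial_segment: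
  fixes f :: "real \<Rightarrow> real"
  assumes "t \<in> {0..T}"
  shows "(LINT s:{0..t}|lebesgue. f s) = (\<integral>s. (if s \<le> t then f s else 0) \<partial>lebesgue_on {0..T})"
  unfolding set_lebesgue_integral_def
  by (subst integral_restrict_space) (use assms in \<open>auto intro!: Bochner_Integration.integral_cong simp: indicator_def\<close>)

lemma set_lebesgue_integral_final_segment:
  fixes f :: "real \<Rightarrow> real"
  assumes "s \<in> {0..T}"
  shows "(LINT t:{s..T}|lebesgue. f t) = (\<integral>t. (if s \<le> t then f t else 0) \<partial>lebesgue_on {0..T})"
  unfolding set_lebesgue_integral_def
  by (subst integral_restrict_space) (use assms in \<open>auto intro!: Bochner_Integration.integral_cong simp: indicator_def\<close>)

lemma L1_iff_integrable: "u \<in> L1 T \<longleftrightarrow> integrable (lebesgue_on {0..T}) u"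
  unfolding L1_def set_integrable_def by (subst integrable_restrict_space) auto

section \<open>The state equation and its propagator\<close>

text \<open>
  The data of the state equation. The running cost and the control are parameters of the individual
  results instead, since two controls are to be compared.
\<close>

locale controlled_gbm = brownian_motion M Ft W
  for M :: "'a measure" and Ft :: "real \<Rightarrow> 'a measure" and W :: "real \<Rightarrow> 'a \<Rightarrow> real" +
  fixes T p :: real and a :: "real \<Rightarrow> real" and z :: "real \<Rightarrow> 'a \<Rightarrow> real"
  assumes a: "a \<in> Linf T"
    and z_measurable: "(\<lambda>(t, \<omega>). z t \<omega>) \<in> borel_measurable (restrict_space borel {0..T} \<Otimes>\<^sub>M M)"
    and p: "p > 1"
    and z_Lp: "\<And>t. t \<in> {0..T} \<Longrightarrow> integrable M (\<lambda>\<omega>. \<bar>z t \<omega>\<bar> powr p)"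
    and z_norm: "set_integrable lebesgue {0..T} (\<lambda>t. (\<integral>\<omega>. \<bar>z t \<omega>\<bar> powr p \<partial>M) powr (2 / p))"
begin

abbreviation "\<Lambda> \<equiv> lebesgue_on {0..T}"

text \<open>
  The propagator of the homogeneous equation \<open>d\<xi> = a \<xi> dt + \<xi> dW\<close>: it carries a unit mass put into
  the state at time \<open>s\<close> to time \<open>t\<close>.
\<close>

definition flow :: "real \<Rightarrow> real \<Rightarrow> 'a \<Rightarrow> real" where
  "flow s t \<omega> = geom_bm W t \<omega> / geom_bm W s \<omega> * exp (prim a t - prim a s)"

text \<open>
  The square of the \<open>L\<^sup>p\<close> norm of \<open>z s\<close>. Adding \<open>1\<close> to it gives a bound for the norm itself that
  is integrable in time.
\<close>

definition z_weight :: "real \<Rightarrow> real" where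
  "z_weight s = (\<integral>\<omega>. \<bar>z s \<omega>\<bar> powr p \<partial>M) powr (2 / p)"

sublocale time: finite_measure \<Lambda>
  by (rule finite_measure_lebesgue_on) simp

sublocale time_space: pair_sigma_finite \<Lambda> M ..

sublocale time_time_space: pair_sigma_finite \<Lambda> "\<Lambda> \<Otimes>\<^sub>M M"
  by (intro pair_sigma_finite.intro time.sigma_finite_measure_axioms)
     (rule time_space.sigma_finite_measure_axioms)

lemma time_measurable: "f \<in> measurable N \<Lambda> \<Longrightarrow> f \<in> borel_measurable N"
proof -
  have "(\<lambda>x. x) \<in> borel_measurable \<Lambda>"
    by (intro measurable_restrict_space1 measurable_completion) simp
  then show "f \<in> measurable N \<Lambda> \<Longrightarrow> f \<in> borel_measurable N"
    by (rule measurable_compose[rotated])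
qed

lemma time_in_interval: "f \<in> measurable N \<Lambda> \<Longrightarrow> x \<in> space N \<Longrightarrow> f x \<in> {0..T}"
  using measurable_space[of f N \<Lambda> x] by simp

text \<open>
  A continuous process is jointly measurable, because it is the limit of its discretisations in
  time, each of which takes only countably many time values.
\<close>

lemma W_measurable [measurable (raw)]:
  assumes f: "f \<in> measurable N \<Lambda>" and g[measurable]: "g \<in> measurable N M"
  shows "(\<lambda>x. W (f x) (g x)) \<in> borel_measurable N"
proof (rule borel_measurable_LIMSEQ_real)
  have [measurable]: "f \<in> borel_measurable N"
    using f by (rule time_measurable)
  let ?grid = "\<lambda>n x. real (nat \<lfloor>f x * real (Suc n)\<rfloor>) / real (Suc n)"
  fix n
  have W_grid: "(\<lambda>x. W (real i / real (Suc n)) (g x)) \<in> borel_measurable N" for i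
  proof -
    have "W (real i / real (Suc n)) \<in> borel_measurable M"
      using measurable_from_subalg[OF Ft_subalgebra W_adapted] by simp
    from measurable_compose[OF g this] show ?thesis .
  qed
  show "(\<lambda>x. W (?grid n x) (g x)) \<in> borel_measurable N"
    by (rule measurable_compose_countable[where f = "\<lambda>i x. W (real i / real (Suc n)) (g x)"])
       (use W_grid in simp, measurable)
next
  fix x assume x: "x \<in> space N"
  let ?grid = "\<lambda>n. real (nat \<lfloor>f x * real (Suc n)\<rfloor>) / real (Suc n)"
  have fx: "f x \<ge> 0" and gx: "g x \<in> space M"
    using time_in_interval[OF f x] measurable_space[OF g x] by auto
  have "?grid \<longlonglongrightarrow> f x"
  proof (rule real_tendsto_sandwich[OF always_eventually always_eventually])
    show "\<forall>n. f x - 1 / real (Suc n) \<le> ?grid n"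
    proof
      fix n
      have "f x * real (Suc n) - 1 \<le> real (nat \<lfloor>f x * real (Suc n)\<rfloor>)" by linarith
      then have "(f x * real (Suc n) - 1) / real (Suc n) \<le> ?grid n"
        by (rule divide_right_mono) simp
      then show "f x - 1 / real (Suc n) \<le> ?grid n"
        by (simp add: diff_divide_distrib del: of_nat_Suc)
    qed
    show "\<forall>n. ?grid n \<le> f x"
    proof
      fix n
      have "real (nat \<lfloor>f x * real (Suc n)\<rfloor>) \<le> f x * real (Suc n)"
        using fx by (simp add: of_nat_nat)
      then have "?grid n \<le> f x * real (Suc n) / real (Suc n)"
        by (rule divide_right_mono) simp
      then show "?grid n \<le> f x"
        by (simp del: of_nat_Suc)
    qed
    show "(\<lambda>n. f x - 1 / real (Suc n)) \<longlonglongrightarrow> f x"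
      using tendsto_diff[OF tendsto_const LIMSEQ_inverse_real_of_nat, of "f x"] by (simp add: inverse_eq_divide)
  qed simp
  then show "(\<lambda>n. W (?grid n) (g x)) \<longlonglongrightarrow> W (f x) (g x)"
    by (rule continuous_on_tendsto_compose[OF W_continuous[OF gx]]) (use fx in auto)
qed

lemma z_compose_measurable [measurable (raw)]:
  assumes f: "f \<in> measurable N \<Lambda>" and g[measurable]: "g \<in> measurable N M"
  shows "(\<lambda>x. z (f x) (g x)) \<in> borel_measurable N"
proof -
  have "f \<in> measurable N (restrict_space borel {0..T})"
    by (rule measurable_restrict_space2[OF Pi_I[OF time_in_interval[OF f]] time_measurable[OF f]])
  then have "(\<lambda>x. (f x, g x)) \<in> measurable N (restrict_space borel {0..T} \<Otimes>\<^sub>M M)"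
    by measurable
  from measurable_compose[OF this z_measurable] show ?thesis by simp
qed

lemma integrable_a: "integrable \<Lambda> a"
proof -
  obtain C where "AE t in \<Lambda>. norm (a t) \<le> C" "a \<in> borel_measurable \<Lambda>"
    using a unfolding Linf_def real_norm_def by blast
  then show ?thesis by (rule time.integrable_const_bound)
qed

lemma prim_measurable [measurable]: "prim a \<in> borel_measurable \<Lambda>"
proof -
  have [measurable]: "fst \<in> borel_measurable (\<Lambda> \<Otimes>\<^sub>M \<Lambda>)" "snd \<in> borel_measurable (\<Lambda> \<Otimes>\<^sub>M \<Lambda>)"
    by (auto intro: time_measurable)
  have [measurable]: "a \<in> borel_measurable \<Lambda>"
    using integrable_a by simp
  have "(\<lambda>t. \<integral>s. (if s \<le> t then a s else 0) \<partial>\<Lambda>) \<in> borel_measurable \<Lambda>"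
    by (rule time.borel_measurable_lebesgue_integral) (unfold split_beta', measurable)
  then show ?thesis
    by (rule measurable_cong[THEN iffD1, rotated])
       (simp add: prim_def set_lebesgue_integral_initial_segment[where T = T])
qed

lemma prim_bound: "t \<in> {0..T} \<Longrightarrow> \<bar>prim a t\<bar> \<le> (\<integral>s. \<bar>a s\<bar> \<partial>\<Lambda>)"
proof -
  assume t: "t \<in> {0..T}"
  have "\<bar>\<integral>s. (if s \<le> t then a s else 0) \<partial>\<Lambda>\<bar> \<le> (\<integral>s. \<bar>if s \<le> t then a s else 0\<bar> \<partial>\<Lambda>)"
    by (rule integral_abs_bound)
  also have "\<dots> \<le> (\<integral>s. \<bar>a s\<bar> \<partial>\<Lambda>)"
    using integrable_a by (intro Bochner_Integration.integral_mono_AE') auto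
  finally show ?thesis
    using t by (simp add: prim_def set_lebesgue_integral_initial_segment[where T = T])
qed

lemma flow_measurable [measurable (raw)]:
  assumes [measurable]: "f \<in> measurable N \<Lambda>" "g \<in> measurable N \<Lambda>" "h \<in> measurable N M"
  shows "(\<lambda>x. flow (f x) (g x) (h x)) \<in> borel_measurable N"
proof -
  have [measurable]: "f \<in> borel_measurable N" "g \<in> borel_measurable N"
    by (auto intro: time_measurable)
  show ?thesis unfolding flow_def geom_bm_def by measurable
qed

lemma flow_pos: "flow s t \<omega> > 0"
  by (simp add: flow_def geom_bm_def)

lemma flow_eq: "flow s t \<omega> = exp ((W t \<omega> - W s \<omega>) - (t - s) / 2 + (prim a t - prim a s))"
  unfolding flow_def geom_bm_def
  by (simp only: exp_diff[symmetric] exp_add[symmetric] exp_inj_iff diff_divide_distrib)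

text \<open>
  Paths of \<open>W\<close> are continuous, hence bounded on the compact interval. The bound depends on the path,
  which is enough for integrability in time along a fixed path.
\<close>

lemma flow_bounded:
  assumes \<omega>: "\<omega> \<in> space M"
  obtains K where "\<And>s t. s \<in> {0..T} \<Longrightarrow> t \<in> {0..T} \<Longrightarrow> flow s t \<omega> \<le> K"
proof -
  have "continuous_on {0..T} (\<lambda>t. W t \<omega>)"
    using W_continuous[OF \<omega>] by (rule continuous_on_subset) auto
  then have "bounded ((\<lambda>t. W t \<omega>) ` {0..T})"
    by (intro compact_imp_bounded compact_continuous_image) auto
  then obtain b where b: "\<forall>t\<in>{0..T}. \<bar>W t \<omega>\<bar> \<le> b"
    by (auto simp: bounded_iff)
  show ?thesis
  proof (rule that)
    fix s t assume st: "s \<in> {0..T}" "t \<in> {0..T}"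
    show "flow s t \<omega> \<le> exp (2 * b + T / 2 + 2 * (\<integral>s. \<bar>a s\<bar> \<partial>\<Lambda>))"
    proof -
      have "\<bar>W s \<omega>\<bar> \<le> b" "\<bar>W t \<omega>\<bar> \<le> b" "- (t - s) / 2 \<le> T / 2"
        using b st by auto
      then show ?thesis
        unfolding flow_eq exp_le_cancel_iff using prim_bound[OF st(1)] prim_bound[OF st(2)] by linarith
    qed
  qed
qed

text \<open>
  The logarithm of the propagator is a normal increment of variance \<open>t - s \<le> T\<close> plus a bounded term.
\<close>

lemma flow_moment:
  assumes r: "r \<ge> 0"
  obtains C where "C \<ge> 0"
    "\<And>s t. 0 \<le> s \<Longrightarrow> s \<le> t \<Longrightarrow> t \<le> T \<Longrightarrow> (\<integral>\<^sup>+ \<omega>. ennreal (flow s t \<omega> powr r) \<partial>M) \<le> ennreal C"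
proof (rule that)
  define B where "B = (\<integral>s. \<bar>a s\<bar> \<partial>\<Lambda>)"
  let ?C = "exp (r * (2 * B)) * exp (r\<^sup>2 * T / 2)"
  show "?C \<ge> 0" by simp
  fix s t assume st: "0 \<le> s" "s \<le> t" "t \<le> T"
  have exp_moment: "(\<integral>\<^sup>+ \<omega>. ennreal (exp (r * (W t \<omega> - W s \<omega>))) \<partial>M) = ennreal (exp (r\<^sup>2 * (t - s) / 2))"
  proof (cases "s = t")
    case True
    then show ?thesis by (simp add: emeasure_space_1)
  next
    case False
    then show ?thesis
      using nn_integral_exp_normal[OF W_increment_normal, of s t r] st by simp
  qed
  have "flow s t \<omega> powr r \<le> exp (r * (2 * B)) * exp (r * (W t \<omega> - W s \<omega>))" for \<omega>
  proof -
    have "(W t \<omega> - W s \<omega>) - (t - s) / 2 + (prim a t - prim a s) \<le> 2 * B + (W t \<omega> - W s \<omega>)"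
    proof -
      have "\<bar>prim a s\<bar> \<le> B" "\<bar>prim a t\<bar> \<le> B"
        using prim_bound st by (auto simp: B_def)
      then have "prim a t - prim a s \<le> 2 * B" "0 \<le> (t - s) / 2"
        using st by (auto simp: abs_le_iff)
      then show ?thesis by linarith
    qed
    then have "exp (r * ((W t \<omega> - W s \<omega>) - (t - s) / 2 + (prim a t - prim a s)))
        \<le> exp (r * (2 * B + (W t \<omega> - W s \<omega>)))"
      using r by (simp only: exp_le_cancel_iff mult_left_mono)
    also have "\<dots> = exp (r * (2 * B)) * exp (r * (W t \<omega> - W s \<omega>))"
      by (simp only: distrib_left exp_add)
    finally show ?thesis
      by (simp only: flow_eq powr_def exp_not_eq_zero if_False ln_exp)
  qed
  then have "(\<integral>\<^sup>+ \<omega>. ennreal (flow s t \<omega> powr r) \<partial>M)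
      \<le> (\<integral>\<^sup>+ \<omega>. ennreal (exp (r * (2 * B))) * ennreal (exp (r * (W t \<omega> - W s \<omega>))) \<partial>M)"
    by (intro nn_integral_mono) (simp flip: ennreal_mult add: ennreal_leI)
  also have "\<dots> = ennreal (exp (r * (2 * B))) * (\<integral>\<^sup>+ \<omega>. ennreal (exp (r * (W t \<omega> - W s \<omega>))) \<partial>M)"
  proof -
    have [measurable]: "W s \<in> borel_measurable M" "W t \<in> borel_measurable M"
      using measurable_from_subalg[OF Ft_subalgebra W_adapted] st by auto
    show ?thesis by (rule nn_integral_cmult) measurable
  qed
  also have "\<dots> \<le> ennreal ?C"
    unfolding exp_moment using st by (simp flip: ennreal_mult add: mult_left_mono ennreal_leI)
  finally show "(\<integral>\<^sup>+ \<omega>. ennreal (flow s t \<omega> powr r) \<partial>M) \<le> ennreal ?C" .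
qed

lemma state_eq_flow:
  assumes t: "t \<in> {0..T}"
  shows "state W a z u t \<omega> = (\<integral>s. (if s \<le> t then flow s t \<omega> * (z s \<omega> - u s) else 0) \<partial>\<Lambda>)"
proof -
  have "state W a z u t \<omega> = (LINT s:{0..t}|lebesgue. geom_bm W t \<omega> * exp (prim a t) *
      (exp (- prim a s) / geom_bm W s \<omega> * (z s \<omega> - u s)))"
    unfolding state_def by (rule set_integral_mult_right[symmetric])
  also have "\<dots> = (LINT s:{0..t}|lebesgue. flow s t \<omega> * (z s \<omega> - u s))"
    by (intro set_lebesgue_integral_cong) (auto simp: flow_def exp_diff exp_minus field_simps)
  finally show ?thesis
    using t by (simp only: set_lebesgue_integral_initial_segment)
qed

lemma state_measurable [measurable (raw)]:
  assumes [measurable]: "u \<in> borel_measurable \<Lambda>"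
    and f[measurable]: "f \<in> measurable N \<Lambda>" and [measurable]: "g \<in> measurable N M"
  shows "(\<lambda>x. state W a z u (f x) (g x)) \<in> borel_measurable N"
proof -
  have [measurable]: "(\<lambda>x. f (fst x)) \<in> borel_measurable (N \<Otimes>\<^sub>M \<Lambda>)" "snd \<in> borel_measurable (N \<Otimes>\<^sub>M \<Lambda>)"
    by (auto intro: time_measurable)
  have "(\<lambda>x. \<integral>s. (if s \<le> f x then flow s (f x) (g x) * (z s (g x) - u s) else 0) \<partial>\<Lambda>) \<in> borel_measurable N"
    by (rule time.borel_measurable_lebesgue_integral) (unfold split_beta', measurable)
  then show ?thesis
    by (rule measurable_cong[THEN iffD1, rotated]) (use state_eq_flow time_in_interval[OF f] in auto)
qed

section \<open>Moments of the state\<close>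

lemma integrable_z_weight: "integrable \<Lambda> z_weight"
  using z_norm unfolding z_weight_def[abs_def] set_integrable_def
  by (subst integrable_restrict_space) auto

lemma z_weight_nonneg: "0 \<le> z_weight s"
  by (simp add: z_weight_def)

text \<open>
  With \<open>N = z_weight s\<close> the \<open>p\<close>-th moment of \<open>z s\<close> is \<open>N powr (p / 2)\<close>, which is at most
  \<open>k powr p\<close> as soon as \<open>k \<ge> 1\<close> and \<open>k \<ge> N\<close>.
\<close>

lemma z_normalized_moment:
  assumes s: "s \<in> {0..T}" and k: "1 + z_weight s \<le> k"
  shows "(\<integral>\<^sup>+ \<omega>. ennreal ((\<bar>z s \<omega>\<bar> / k) powr p) \<partial>M) \<le> 1"
proof -
  let ?E = "\<integral>\<omega>. \<bar>z s \<omega>\<bar> powr p \<partial>M"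
  have k1: "k \<ge> 1"
    using k z_weight_nonneg[of s] by linarith
  have "?E = z_weight s powr (p / 2)"
    using p by (simp add: z_weight_def powr_powr)
  also have "\<dots> \<le> k powr (p / 2)"
    using k z_weight_nonneg[of s] p by (intro powr_mono2) auto
  also have "\<dots> \<le> k powr p"
    using k1 p by (intro powr_mono) auto
  finally have E_le: "?E \<le> k powr p" .
  have "(\<integral>\<^sup>+ \<omega>. ennreal ((\<bar>z s \<omega>\<bar> / k) powr p) \<partial>M) = (\<integral>\<^sup>+ \<omega>. ennreal (\<bar>z s \<omega>\<bar> powr p / k powr p) \<partial>M)"
    using k1 by (simp add: powr_divide)
  also have "\<dots> = ennreal (?E / k powr p)"
    using z_Lp[OF s] k1 by (subst nn_integral_eq_integral) auto
  also have "\<dots> \<le> 1"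
    using E_le k1 by (simp add: ennreal_le_1)
  finally show ?thesis .
qed

text \<open>
  Without this, the integral that defines the state could have its default value \<open>0\<close> and the state
  would not be affine in the control. By Fubini's theorem it suffices that the first moment of
  \<open>z s\<close> is integrable in \<open>s\<close>.
\<close>

lemma AE_integrable_z: "AE \<omega> in M. integrable \<Lambda> (\<lambda>s. z s \<omega>)"
proof -
  have [measurable]: "z_weight \<in> borel_measurable \<Lambda>"
    using integrable_z_weight by simp
  have E_z: "(\<integral>\<^sup>+ \<omega>. ennreal \<bar>z s \<omega>\<bar> \<partial>M) \<le> ennreal (2 * (1 + z_weight s))" if s: "s \<in> space \<Lambda>" for s
  proof -
    define k where "k = 1 + z_weight s"
    have k: "k \<ge> 1"
      using z_weight_nonneg[of s] by (simp add: k_def)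
    have [measurable]: "z s \<in> borel_measurable M"
      by (rule z_compose_measurable[OF measurable_const measurable_ident_sets[OF refl], OF s])
    have "\<bar>z s \<omega>\<bar> \<le> k * (1 + (\<bar>z s \<omega>\<bar> / k) powr p)" for \<omega>
    proof -
      have "x \<le> 1 + x powr p" if "x \<ge> 0" for x :: real
      proof (cases "x \<le> 1")
        case False
        then have "x powr 1 \<le> x powr p"
          using p by (intro powr_mono) auto
        then show ?thesis using False by simp
      qed (use powr_ge_zero[of x p] in linarith)
      from this[of "\<bar>z s \<omega>\<bar> / k"] have "k * (\<bar>z s \<omega>\<bar> / k) \<le> k * (1 + (\<bar>z s \<omega>\<bar> / k) powr p)"
        using k by (intro mult_left_mono) auto
      then show ?thesis using k by simp
    qed
    then have "(\<integral>\<^sup>+ \<omega>. ennreal \<bar>z s \<omega>\<bar> \<partial>M) \<le> (\<integral>\<^sup>+ \<omega>. ennreal k * (1 + ennreal ((\<bar>z s \<omega>\<bar> / k) powr p)) \<partial>M)"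
      using k by (intro nn_integral_mono) (simp add: ennreal_leI flip: ennreal_mult ennreal_1 ennreal_plus)
    also have "\<dots> = ennreal k * (1 + (\<integral>\<^sup>+ \<omega>. ennreal ((\<bar>z s \<omega>\<bar> / k) powr p) \<partial>M))"
      by (subst nn_integral_cmult, measurable, subst nn_integral_add) (auto simp: emeasure_space_1)
    also have "\<dots> \<le> ennreal k * (1 + 1)"
      using s by (intro mult_left_mono add_left_mono z_normalized_moment) (auto simp: k_def)
    also have "\<dots> = ennreal (2 * k)"
      using k by (simp add: ennreal_mult mult.commute)
    finally show ?thesis by (simp add: k_def)
  qed
  have "(\<integral>\<^sup>+ \<omega>. (\<integral>\<^sup>+ s. ennreal \<bar>z s \<omega>\<bar> \<partial>\<Lambda>) \<partial>M) = (\<integral>\<^sup>+ s. (\<integral>\<^sup>+ \<omega>. ennreal \<bar>z s \<omega>\<bar> \<partial>M) \<partial>\<Lambda>)"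
    by (rule time_space.Fubini') measurable
  also have "\<dots> \<le> (\<integral>\<^sup>+ s. ennreal (2 * (1 + z_weight s)) \<partial>\<Lambda>)"
    by (rule nn_integral_mono) (rule E_z)
  also have "\<dots> < \<infinity>"
    using integrable_z_weight z_weight_nonneg
    by (subst nn_integral_eq_integral) (auto simp: add_nonneg_nonneg)
  finally have "AE \<omega> in M. (\<integral>\<^sup>+ s. ennreal \<bar>z s \<omega>\<bar> \<partial>\<Lambda>) \<noteq> \<infinity>"
    by (intro nn_integral_PInf_AE) (auto simp: less_top)
  then show ?thesis
    using AE_space
  proof eventually_elim
    case (elim \<omega>)
    then have "(\<lambda>s. z s \<omega>) \<in> borel_measurable \<Lambda>"
      by (intro z_compose_measurable) auto
    with elim show ?case
      by (intro integrableI_bounded) (auto simp: less_top)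
  qed
qed

lemma integrable_flow_mult:
  assumes \<omega>: "\<omega> \<in> space M" and t: "t \<in> {0..T}" and f: "integrable \<Lambda> f"
  shows "integrable \<Lambda> (\<lambda>s. if s \<le> t then flow s t \<omega> * f s else 0)"
proof -
  obtain K where K: "\<And>s t. s \<in> {0..T} \<Longrightarrow> t \<in> {0..T} \<Longrightarrow> flow s t \<omega> \<le> K"
    using flow_bounded[OF \<omega>] by blast
  have [measurable]: "(\<lambda>s. flow s t \<omega>) \<in> borel_measurable \<Lambda>" "f \<in> borel_measurable \<Lambda>"
      "(\<lambda>s. s) \<in> borel_measurable \<Lambda>"
    using \<omega> t f by (auto intro: flow_measurable time_measurable)
  show ?thesis
  proof (rule Bochner_Integration.integrable_bound[where f = "\<lambda>s. K * f s"])
    show "AE s in \<Lambda>. norm (if s \<le> t then flow s t \<omega> * f s else 0) \<le> norm (K * f s)"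
    proof (rule AE_I2)
      fix s assume "s \<in> space \<Lambda>"
      then have "0 < flow s t \<omega>" "flow s t \<omega> \<le> K"
        using K t flow_pos by auto
      then show "norm (if s \<le> t then flow s t \<omega> * f s else 0) \<le> norm (K * f s)"
        by (auto simp: abs_mult intro!: mult_right_mono)
    qed
  qed (use f in \<open>auto\<close>)
qed

text \<open>
  Jensen's inequality is used with the weight \<open>h = 1 + z_weight + |u|\<close>. It is integrable in time, and
  it is so large that \<open>(z s - u s) / h s\<close> has a \<open>p\<close>-th moment bounded uniformly in \<open>s\<close>; the gap
  between \<open>q\<close> and \<open>p\<close> then absorbs the propagator.
\<close>

lemma state_moment:
  assumes u: "integrable \<Lambda> u" and q: "1 \<le> q" "q < p"
  obtains C where "C \<ge> 0"
    "\<And>t. t \<in> {0..T} \<Longrightarrow> (\<integral>\<^sup>+ \<omega>. ennreal (\<bar>state W a z u t \<omega>\<bar> powr q) \<partial>M) \<le> ennreal C"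
proof -
  \<comment> \<open>The moment of the propagator that remains after splitting off the \<open>p\<close>-th moment of \<open>z\<close>.\<close>
  define r where "r = q * (p / (p - q))"
  have "r \<ge> 0" using q by (simp add: r_def)
  then obtain C where C: "C \<ge> 0"
    "\<And>s t. 0 \<le> s \<Longrightarrow> s \<le> t \<Longrightarrow> t \<le> T \<Longrightarrow> (\<integral>\<^sup>+ \<omega>. ennreal (flow s t \<omega> powr r) \<partial>M) \<le> ennreal C"
    using flow_moment by blast
  define h where "h s = 1 + z_weight s + \<bar>u s\<bar>" for s
  have h: "integrable \<Lambda> h"
    unfolding h_def using integrable_z_weight u by auto
  have h1: "h s \<ge> 1" for s
    using z_weight_nonneg[of s] by (simp add: h_def)
  have [measurable]: "u \<in> borel_measurable \<Lambda>" "h \<in> borel_measurable \<Lambda>"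
    using u h by auto
  define H where "H = (\<integral>s. h s \<partial>\<Lambda>)"
  have H: "H \<ge> 0"
    unfolding H_def by (intro integral_nonneg_AE AE_I2) (use h1 order.trans[OF zero_le_one] in blast)
  define D where "D = 2 powr p * 2 + C"
  have D: "D \<ge> 0" using C by (simp add: D_def)
  define X where "X s t \<omega> = (if s \<le> t then flow s t \<omega> * (z s \<omega> - u s) else 0)" for s t \<omega>
  have X_moment: "(\<integral>\<^sup>+ \<omega>. ennreal ((\<bar>X s t \<omega>\<bar> / h s) powr q) \<partial>M) \<le> ennreal D"
    if s: "s \<in> {0..T}" and t: "t \<in> {0..T}" for s t
  proof (cases "s \<le> t")
    case False
    then show ?thesis using q by (simp add: X_def)
  next
    case True
    have [measurable]: "z s \<in> borel_measurable M" "flow s t \<in> borel_measurable M"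
      using s t by (auto intro!: z_compose_measurable[OF measurable_const measurable_ident_sets[OF refl]]
          flow_measurable[OF measurable_const measurable_const measurable_ident_sets[OF refl]])
    have "(\<bar>X s t \<omega>\<bar> / h s) powr q \<le> 2 powr p * ((\<bar>z s \<omega>\<bar> / h s) powr p + 1) + flow s t \<omega> powr r" for \<omega>
    proof -
      define w where "w = \<bar>z s \<omega>\<bar> / h s"
      have w: "w \<ge> 0" using h1[of s] by (simp add: w_def)
      have hs: "h s > 0" using h1[of s] by linarith
      have "\<bar>z s \<omega> - u s\<bar> \<le> \<bar>z s \<omega>\<bar> + h s"
        using z_weight_nonneg[of s] by (auto simp: h_def)
      then have "\<bar>z s \<omega> - u s\<bar> / h s \<le> (\<bar>z s \<omega>\<bar> + h s) / h s"
        using hs by (intro divide_right_mono) auto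
      also have "\<dots> = w + 1"
        using hs by (simp add: w_def add_divide_distrib)
      finally have "flow s t \<omega> * (\<bar>z s \<omega> - u s\<bar> / h s) \<le> flow s t \<omega> * (w + 1)"
        using flow_pos[of s t \<omega>] by (intro mult_left_mono) auto
      then have "\<bar>X s t \<omega>\<bar> / h s \<le> (w + 1) * flow s t \<omega>"
        using True flow_pos[of s t \<omega>] by (simp add: X_def abs_mult mult.commute)
      then have "(\<bar>X s t \<omega>\<bar> / h s) powr q \<le> ((w + 1) * flow s t \<omega>) powr q"
        using q hs by (intro powr_mono2) auto
      also have "\<dots> = (w + 1) powr q * flow s t \<omega> powr q"
        using w flow_pos[of s t \<omega>] by (simp add: powr_mult)
      also have "\<dots> \<le> (w + 1) powr p + (flow s t \<omega> powr q) powr (p / (p - q))"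
        using w q by (intro powr_mult_le_add_powr) auto
      also have "(flow s t \<omega> powr q) powr (p / (p - q)) = flow s t \<omega> powr r"
        by (simp add: powr_powr r_def)
      also have "(w + 1) powr p \<le> 2 powr p * (w powr p + 1)"
      proof -
        \<comment> \<open>The bound \<open>w + 1 \<le> 2 max w 1\<close> replaces convexity of the power.\<close>
        have "(w + 1) powr p \<le> (2 * max w 1) powr p"
          using w p by (intro powr_mono2) auto
        also have "\<dots> = 2 powr p * max w 1 powr p"
          using w by (simp add: powr_mult)
        also have "\<dots> \<le> 2 powr p * (w powr p + 1)"
          by (intro mult_left_mono) (auto simp: max_def)
        finally show ?thesis .
      qed
      finally show ?thesis by (simp add: w_def)
    qed
    then have "(\<integral>\<^sup>+ \<omega>. ennreal ((\<bar>X s t \<omega>\<bar> / h s) powr q) \<partial>M)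
        \<le> (\<integral>\<^sup>+ \<omega>. ennreal (2 powr p) * (ennreal ((\<bar>z s \<omega>\<bar> / h s) powr p) + 1) + ennreal (flow s t \<omega> powr r) \<partial>M)"
      by (intro nn_integral_mono) (simp add: ennreal_leI flip: ennreal_mult ennreal_1 ennreal_plus)
    also have "\<dots> = ennreal (2 powr p) * ((\<integral>\<^sup>+ \<omega>. ennreal ((\<bar>z s \<omega>\<bar> / h s) powr p) \<partial>M) + 1)
        + (\<integral>\<^sup>+ \<omega>. ennreal (flow s t \<omega> powr r) \<partial>M)"
      by (simp add: nn_integral_add nn_integral_cmult emeasure_space_1)
    also have "\<dots> \<le> ennreal (2 powr p) * (1 + 1) + ennreal C"
      using s t True by (intro add_mono mult_left_mono z_normalized_moment C) (auto simp: h_def)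
    also have "\<dots> = ennreal D"
      using C by (simp add: D_def ennreal_mult ennreal_plus)
    finally show ?thesis .
  qed
  show ?thesis
  proof (rule that)
    show "H powr (q - 1) * (H * D) \<ge> 0" using H D by simp
    fix t assume t: "t \<in> {0..T}"
    have [measurable]: "(\<lambda>x. X (snd x) t (fst x)) \<in> borel_measurable (M \<Otimes>\<^sub>M \<Lambda>)"
      "(\<lambda>x. X (fst x) t (snd x)) \<in> borel_measurable (\<Lambda> \<Otimes>\<^sub>M M)"
    proof -
      have [measurable]: "fst \<in> borel_measurable (\<Lambda> \<Otimes>\<^sub>M M)" "snd \<in> borel_measurable (M \<Otimes>\<^sub>M \<Lambda>)"
          "t \<in> space \<Lambda>"
        using t by (auto intro: time_measurable)
      show "(\<lambda>x. X (snd x) t (fst x)) \<in> borel_measurable (M \<Otimes>\<^sub>M \<Lambda>)"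
        "(\<lambda>x. X (fst x) t (snd x)) \<in> borel_measurable (\<Lambda> \<Otimes>\<^sub>M M)"
        unfolding X_def by measurable
    qed
    have "(\<integral>\<^sup>+ \<omega>. ennreal (\<bar>state W a z u t \<omega>\<bar> powr q) \<partial>M)
        \<le> (\<integral>\<^sup>+ \<omega>. ennreal (H powr (q - 1)) * (\<integral>\<^sup>+ s. ennreal (h s * (\<bar>X s t \<omega>\<bar> / h s) powr q) \<partial>\<Lambda>) \<partial>M)"
    proof (intro nn_integral_mono)
      fix \<omega>
      show "ennreal (\<bar>state W a z u t \<omega>\<bar> powr q)
          \<le> ennreal (H powr (q - 1)) * (\<integral>\<^sup>+ s. ennreal (h s * (\<bar>X s t \<omega>\<bar> / h s) powr q) \<partial>\<Lambda>)"
        unfolding state_eq_flow[OF t] X_def[symmetric] H_def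
        by (rule weighted_jensen_powr[OF h _ q(1)]) (use h1 order.strict_trans2[OF zero_less_one] in blast)
    qed
    also have "\<dots> = ennreal (H powr (q - 1)) *
        (\<integral>\<^sup>+ \<omega>. (\<integral>\<^sup>+ s. ennreal (h s * (\<bar>X s t \<omega>\<bar> / h s) powr q) \<partial>\<Lambda>) \<partial>M)"
      by (rule nn_integral_cmult) measurable
    also have "(\<integral>\<^sup>+ \<omega>. (\<integral>\<^sup>+ s. ennreal (h s * (\<bar>X s t \<omega>\<bar> / h s) powr q) \<partial>\<Lambda>) \<partial>M)
        = (\<integral>\<^sup>+ s. (\<integral>\<^sup>+ \<omega>. ennreal (h s * (\<bar>X s t \<omega>\<bar> / h s) powr q) \<partial>M) \<partial>\<Lambda>)"
      by (rule time_space.Fubini') (unfold split_beta', measurable)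
    also have "\<dots> \<le> (\<integral>\<^sup>+ s. ennreal (h s) * ennreal D \<partial>\<Lambda>)"
    proof (intro nn_integral_mono)
      fix s assume s: "s \<in> space \<Lambda>"
      have [measurable]: "X s t \<in> borel_measurable M"
        using measurable_compose[OF measurable_Pair1'[OF s]
            \<open>(\<lambda>x. X (fst x) t (snd x)) \<in> borel_measurable (\<Lambda> \<Otimes>\<^sub>M M)\<close>] by simp
      have "(\<integral>\<^sup>+ \<omega>. ennreal (h s * (\<bar>X s t \<omega>\<bar> / h s) powr q) \<partial>M)
          = ennreal (h s) * (\<integral>\<^sup>+ \<omega>. ennreal ((\<bar>X s t \<omega>\<bar> / h s) powr q) \<partial>M)"
        using order.trans[OF zero_le_one h1, of s] by (simp add: ennreal_mult nn_integral_cmult)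
      also have "\<dots> \<le> ennreal (h s) * ennreal D"
        using s t by (intro mult_left_mono X_moment) auto
      finally show "(\<integral>\<^sup>+ \<omega>. ennreal (h s * (\<bar>X s t \<omega>\<bar> / h s) powr q) \<partial>M) \<le> ennreal (h s) * ennreal D" .
    qed
    also have "\<dots> = ennreal (H * D)"
    proof -
      have "(\<integral>\<^sup>+ s. ennreal (h s) \<partial>\<Lambda>) = ennreal H"
        unfolding H_def using h order.trans[OF zero_le_one h1] by (intro nn_integral_eq_integral) auto
      then show ?thesis using H D by (simp add: nn_integral_multc ennreal_mult)
    qed
    finally show "(\<integral>\<^sup>+ \<omega>. ennreal (\<bar>state W a z u t \<omega>\<bar> powr q) \<partial>M) \<le> ennreal (H powr (q - 1) * (H * D))"
      using H D by (simp add: ennreal_mult mult_left_mono)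
  qed
qed

section \<open>Duality and the comparison of costs\<close>

text \<open>
  The estimate behind the exchange of integrals in the duality below: for fixed \<open>s \<le> t\<close> the expectation of the kernel is
  at most \<open>C |v s| k t\<close> with a constant \<open>C\<close>, and this product is integrable over the square. In the
  application \<open>g\<close> is the derivative of the running cost along the state and \<open>v\<close> is a difference of
  two controls.
\<close>

lemma integrable_adjoint_kernel:
  assumes u: "integrable \<Lambda> u" and \<alpha>: "0 \<le> \<alpha>" "\<alpha> < p"
    and k: "integrable \<Lambda> k" "\<And>t. t \<in> {0..T} \<Longrightarrow> 0 \<le> k t"
    and g[measurable]: "(\<lambda>x. g (fst x) (snd x)) \<in> borel_measurable (\<Lambda> \<Otimes>\<^sub>M M)"
    and bound: "\<And>t \<omega>. t \<in> {0..T} \<Longrightarrow> \<bar>g t \<omega>\<bar> \<le> k t * (1 + \<bar>state W a z u t \<omega>\<bar> powr \<alpha>)"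
    and v: "integrable \<Lambda> v"
  shows "integrable (\<Lambda> \<Otimes>\<^sub>M (\<Lambda> \<Otimes>\<^sub>M M))
    (\<lambda>(s, x). v s * (if s \<le> fst x then g (fst x) (snd x) * flow s (fst x) (snd x) else 0))"
proof (rule integrableI_bounded)
  \<comment> \<open>Any exponent strictly between \<open>max \<alpha> 1\<close> and \<open>p\<close> would do: the state has a finite \<open>q\<close>-th moment, and \<open>q\<close> leaves room above \<open>\<alpha>\<close>.\<close>
  define q where "q = (max \<alpha> 1 + p) / 2"
  have q: "1 \<le> q" "\<alpha> < q" "q < p"
    using \<alpha> p by (auto simp: q_def)
  define r where "r = q / (q - \<alpha>)"
  have "r \<ge> 0" using q by (simp add: r_def)
  have [measurable]: "u \<in> borel_measurable \<Lambda>" "v \<in> borel_measurable \<Lambda>" "k \<in> borel_measurable \<Lambda>"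
    using u v k by auto
  obtain C1 where C1: "C1 \<ge> 0" "\<And>t. t \<in> {0..T} \<Longrightarrow>
      (\<integral>\<^sup>+ \<omega>. ennreal (\<bar>state W a z u t \<omega>\<bar> powr q) \<partial>M) \<le> ennreal C1"
    using state_moment[OF u q(1,3)] by blast
  obtain C2 where C2: "C2 \<ge> 0" "\<And>s t. 0 \<le> s \<Longrightarrow> s \<le> t \<Longrightarrow> t \<le> T \<Longrightarrow>
      (\<integral>\<^sup>+ \<omega>. ennreal (flow s t \<omega> powr r) \<partial>M) \<le> ennreal C2"
    using flow_moment[OF \<open>r \<ge> 0\<close>] by blast
  obtain C3 where C3: "C3 \<ge> 0" "\<And>s t. 0 \<le> s \<Longrightarrow> s \<le> t \<Longrightarrow> t \<le> T \<Longrightarrow>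
      (\<integral>\<^sup>+ \<omega>. ennreal (flow s t \<omega> powr 1) \<partial>M) \<le> ennreal C3"
    using flow_moment[of 1] by auto
  define C where "C = C1 + C2 + C3"
  have C: "C \<ge> 0" using C1 C2 C3 by (simp add: C_def)
  let ?K = "\<lambda>(s, x). v s * (if s \<le> fst x then g (fst x) (snd x) * flow s (fst x) (snd x) else 0)"
  have [measurable]: "fst \<in> borel_measurable (\<Lambda> \<Otimes>\<^sub>M (\<Lambda> \<Otimes>\<^sub>M M))"
      "(\<lambda>x. fst (snd x)) \<in> borel_measurable (\<Lambda> \<Otimes>\<^sub>M (\<Lambda> \<Otimes>\<^sub>M M))"
    by (auto intro: time_measurable)
  show K[measurable]: "?K \<in> borel_measurable (\<Lambda> \<Otimes>\<^sub>M (\<Lambda> \<Otimes>\<^sub>M M))"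
    unfolding split_beta' by measurable
  have inner: "(\<integral>\<^sup>+ \<omega>. ennreal (norm (?K (s, t, \<omega>))) \<partial>M) \<le> ennreal \<bar>v s\<bar> * (ennreal (k t) * ennreal C)"
    if s: "s \<in> space \<Lambda>" and t: "t \<in> space \<Lambda>" for s t
  proof (cases "s \<le> t")
    case False
    then show ?thesis by simp
  next
    case True
    have [measurable]: "state W a z u t \<in> borel_measurable M" "flow s t \<in> borel_measurable M"
      using s t by (auto intro!: state_measurable[OF _ measurable_const measurable_ident_sets[OF refl]]
          flow_measurable[OF measurable_const measurable_const measurable_ident_sets[OF refl]])
    have kt: "k t \<ge> 0" using k t by auto
    let ?x = "\<lambda>\<omega>. \<bar>state W a z u t \<omega>\<bar>" and ?y = "flow s t"
    have "norm (?K (s, t, \<omega>)) \<le> \<bar>v s\<bar> * (k t * (?x \<omega> powr q + ?y \<omega> powr r + ?y \<omega> powr 1))" for \<omega>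
    proof -
      have y: "?y \<omega> > 0" by (rule flow_pos)
      have "norm (?K (s, t, \<omega>)) = \<bar>v s\<bar> * (\<bar>g t \<omega>\<bar> * ?y \<omega>)"
        using True y by (simp add: abs_mult)
      also have "\<dots> \<le> \<bar>v s\<bar> * (k t * (1 + ?x \<omega> powr \<alpha>) * ?y \<omega>)"
        using y t by (intro mult_left_mono mult_right_mono bound) auto
      also have "\<dots> = \<bar>v s\<bar> * (k t * (?x \<omega> powr \<alpha> * ?y \<omega> + ?y \<omega> powr 1))"
        using y by (simp add: algebra_simps)
      also have "\<dots> \<le> \<bar>v s\<bar> * (k t * (?x \<omega> powr q + ?y \<omega> powr r + ?y \<omega> powr 1))"
        using y kt \<alpha> q unfolding r_def by (intro mult_left_mono add_right_mono powr_mult_le_add_powr) auto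
      finally show ?thesis .
    qed
    then have "(\<integral>\<^sup>+ \<omega>. ennreal (norm (?K (s, t, \<omega>))) \<partial>M) \<le> (\<integral>\<^sup>+ \<omega>. ennreal \<bar>v s\<bar> * (ennreal (k t) *
        (ennreal (?x \<omega> powr q) + ennreal (?y \<omega> powr r) + ennreal (?y \<omega> powr 1))) \<partial>M)"
      using kt by (intro nn_integral_mono) (simp add: ennreal_leI flip: ennreal_mult ennreal_plus)
    also have "\<dots> = ennreal \<bar>v s\<bar> * (ennreal (k t) * ((\<integral>\<^sup>+ \<omega>. ennreal (?x \<omega> powr q) \<partial>M) +
        (\<integral>\<^sup>+ \<omega>. ennreal (?y \<omega> powr r) \<partial>M) + (\<integral>\<^sup>+ \<omega>. ennreal (?y \<omega> powr 1) \<partial>M)))"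
      by (simp add: nn_integral_cmult nn_integral_add)
    also have "\<dots> \<le> ennreal \<bar>v s\<bar> * (ennreal (k t) * (ennreal C1 + ennreal C2 + ennreal C3))"
      using s t True by (intro mult_left_mono add_mono C1 C2 C3) auto
    also have "ennreal C1 + ennreal C2 + ennreal C3 = ennreal C"
      using C1 C2 C3 by (simp add: C_def)
    finally show ?thesis .
  qed
  have "(\<integral>\<^sup>+ x. ennreal (norm (?K x)) \<partial>(\<Lambda> \<Otimes>\<^sub>M (\<Lambda> \<Otimes>\<^sub>M M)))
      = (\<integral>\<^sup>+ s. (\<integral>\<^sup>+ x. ennreal (norm (?K (s, x))) \<partial>(\<Lambda> \<Otimes>\<^sub>M M)) \<partial>\<Lambda>)"
    by (rule time_space.nn_integral_fst[symmetric]) measurable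
  also have "\<dots> = (\<integral>\<^sup>+ s. (\<integral>\<^sup>+ t. (\<integral>\<^sup>+ \<omega>. ennreal (norm (?K (s, t, \<omega>))) \<partial>M) \<partial>\<Lambda>) \<partial>\<Lambda>)"
  proof (rule nn_integral_cong)
    fix s assume s: "s \<in> space \<Lambda>"
    have [measurable]: "(\<lambda>x. ?K (s, x)) \<in> borel_measurable (\<Lambda> \<Otimes>\<^sub>M M)"
      by (rule measurable_compose[OF measurable_Pair1'[OF s] K])
    show "(\<integral>\<^sup>+ x. ennreal (norm (?K (s, x))) \<partial>(\<Lambda> \<Otimes>\<^sub>M M))
        = (\<integral>\<^sup>+ t. (\<integral>\<^sup>+ \<omega>. ennreal (norm (?K (s, t, \<omega>))) \<partial>M) \<partial>\<Lambda>)"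
      by (rule nn_integral_fst[symmetric, where f = "\<lambda>x. ennreal (norm (?K (s, x)))"]) measurable
  qed
  also have "\<dots> \<le> (\<integral>\<^sup>+ s. (\<integral>\<^sup>+ t. ennreal \<bar>v s\<bar> * (ennreal (k t) * ennreal C) \<partial>\<Lambda>) \<partial>\<Lambda>)"
    by (intro nn_integral_mono inner)
  also have "\<dots> = (\<integral>\<^sup>+ s. ennreal \<bar>v s\<bar> \<partial>\<Lambda>) * ((\<integral>\<^sup>+ t. ennreal (k t) \<partial>\<Lambda>) * ennreal C)"
    by (simp add: nn_integral_cmult nn_integral_multc)
  also have "\<dots> < \<infinity>"
  proof -
    have "(\<integral>\<^sup>+ s. ennreal \<bar>v s\<bar> \<partial>\<Lambda>) = ennreal (\<integral>s. \<bar>v s\<bar> \<partial>\<Lambda>)"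
      using v by (intro nn_integral_eq_integral) auto
    moreover have "(\<integral>\<^sup>+ t. ennreal (k t) \<partial>\<Lambda>) = ennreal (\<integral>t. k t \<partial>\<Lambda>)"
      using k by (intro nn_integral_eq_integral) auto
    ultimately show ?thesis by (simp add: ennreal_mult_less_top)
  qed
  finally show "(\<integral>\<^sup>+ x. ennreal (norm (?K x)) \<partial>(\<Lambda> \<Otimes>\<^sub>M (\<Lambda> \<Otimes>\<^sub>M M))) < \<infinity>" .
qed

text \<open>
  The function \<open>\<eta>\<close> is the change of the state when the control is lowered by \<open>v\<close>. Pairing it with \<open>g\<close> amounts
  to pairing \<open>v\<close> with the adjoint variable \<open>s \<mapsto> \<integral> E [g t * flow s t] dt\<close>, the integral being over
  \<open>t \<ge> s\<close>: both are iterated integrals of one kernel.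
\<close>

lemma adjoint_duality:
  assumes [measurable]: "v \<in> borel_measurable \<Lambda>"
      "(\<lambda>x. g (fst x) (snd x)) \<in> borel_measurable (\<Lambda> \<Otimes>\<^sub>M M)"
    and K: "integrable (\<Lambda> \<Otimes>\<^sub>M (\<Lambda> \<Otimes>\<^sub>M M))
    (\<lambda>(s, x). v s * (if s \<le> fst x then g (fst x) (snd x) * flow s (fst x) (snd x) else 0))"
  defines "\<eta> t \<omega> \<equiv> \<integral>s. (if s \<le> t then flow s t \<omega> * v s else 0) \<partial>\<Lambda>"
  shows "integrable (\<Lambda> \<Otimes>\<^sub>M M) (\<lambda>x. g (fst x) (snd x) * \<eta> (fst x) (snd x))"
    and "(\<integral>x. g (fst x) (snd x) * \<eta> (fst x) (snd x) \<partial>(\<Lambda> \<Otimes>\<^sub>M M))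
      = (\<integral>s. v s * (\<integral>t. (if s \<le> t then \<integral>\<omega>. g t \<omega> * flow s t \<omega> \<partial>M else 0) \<partial>\<Lambda>) \<partial>\<Lambda>)"
proof -
  let ?K = "\<lambda>s x. v s * (if s \<le> fst x then g (fst x) (snd x) * flow s (fst x) (snd x) else 0)"
  have \<eta>: "(\<integral>s. ?K s x \<partial>\<Lambda>) = g (fst x) (snd x) * \<eta> (fst x) (snd x)" for x
  proof -
    have "(\<integral>s. ?K s x \<partial>\<Lambda>)
        = (\<integral>s. g (fst x) (snd x) * (if s \<le> fst x then flow s (fst x) (snd x) * v s else 0) \<partial>\<Lambda>)"
      by (intro Bochner_Integration.integral_cong) auto
    then show ?thesis by (simp add: \<eta>_def)
  qed
  show "integrable (\<Lambda> \<Otimes>\<^sub>M M) (\<lambda>x. g (fst x) (snd x) * \<eta> (fst x) (snd x))"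
    using time_time_space.integrable_snd[OF K] by (simp only: \<eta>)
  have "(\<integral>x. g (fst x) (snd x) * \<eta> (fst x) (snd x) \<partial>(\<Lambda> \<Otimes>\<^sub>M M))
      = (\<integral>x. (\<integral>s. ?K s x \<partial>\<Lambda>) \<partial>(\<Lambda> \<Otimes>\<^sub>M M))"
    by (simp only: \<eta>)
  also have "\<dots> = (\<integral>s. (\<integral>x. ?K s x \<partial>(\<Lambda> \<Otimes>\<^sub>M M)) \<partial>\<Lambda>)"
    by (rule time_time_space.Fubini_integral[OF K])
  also have "\<dots> = (\<integral>s. v s * (\<integral>t. (if s \<le> t then \<integral>\<omega>. g t \<omega> * flow s t \<omega> \<partial>M else 0) \<partial>\<Lambda>) \<partial>\<Lambda>)"
  proof (rule integral_cong_AE)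
    show "(\<lambda>s. \<integral>x. ?K s x \<partial>(\<Lambda> \<Otimes>\<^sub>M M)) \<in> borel_measurable \<Lambda>"
      using time_time_space.integrable_fst[OF K] by simp
  next
    have Fub: "AE s in \<Lambda>. (\<integral>x. ?K s x \<partial>(\<Lambda> \<Otimes>\<^sub>M M))
      = v s * (\<integral>t. (if s \<le> t then \<integral>\<omega>. g t \<omega> * flow s t \<omega> \<partial>M else 0) \<partial>\<Lambda>)"
      using time_time_space.AE_integrable_fst[OF K]
    proof eventually_elim
      case (elim s)
      have "(\<integral>x. ?K s x \<partial>(\<Lambda> \<Otimes>\<^sub>M M)) = (\<integral>t. (\<integral>\<omega>. ?K s (t, \<omega>) \<partial>M) \<partial>\<Lambda>)"
        by (rule time_space.integral_fst'[OF elim, symmetric])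
      also have "\<dots> = (\<integral>t. v s * (if s \<le> t then \<integral>\<omega>. g t \<omega> * flow s t \<omega> \<partial>M else 0) \<partial>\<Lambda>)"
        by (intro Bochner_Integration.integral_cong) auto
      finally show ?case by simp
    qed
    then show "AE s in \<Lambda>. (\<integral>x. ?K s x \<partial>(\<Lambda> \<Otimes>\<^sub>M M))
      = v s * (\<integral>t. (if s \<le> t then \<integral>\<omega>. g t \<omega> * flow s t \<omega> \<partial>M else 0) \<partial>\<Lambda>)" .
    then show "(\<lambda>s. v s * (\<integral>t. (if s \<le> t then \<integral>\<omega>. g t \<omega> * flow s t \<omega> \<partial>M else 0) \<partial>\<Lambda>)) \<in> borel_measurable \<Lambda>"
    proof -
      have [measurable]: "fst \<in> borel_measurable (\<Lambda> \<Otimes>\<^sub>M \<Lambda>)" "snd \<in> borel_measurable (\<Lambda> \<Otimes>\<^sub>M \<Lambda>)"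
        by (auto intro: time_measurable)
      have [measurable]: "(\<lambda>x. g (snd (fst x)) (snd x)) \<in> borel_measurable ((\<Lambda> \<Otimes>\<^sub>M \<Lambda>) \<Otimes>\<^sub>M M)"
        using measurable_compose[of "\<lambda>x. (snd (fst x), snd x)" "(\<Lambda> \<Otimes>\<^sub>M \<Lambda>) \<Otimes>\<^sub>M M" _ _ borel, OF _ assms(2)]
        by simp
      have [measurable]: "(\<lambda>x. \<integral>\<omega>. g (snd x) \<omega> * flow (fst x) (snd x) \<omega> \<partial>M) \<in> borel_measurable (\<Lambda> \<Otimes>\<^sub>M \<Lambda>)"
        by (rule borel_measurable_lebesgue_integral) (unfold split_beta', measurable)
      have "(\<lambda>s. \<integral>t. (if s \<le> t then \<integral>\<omega>. g t \<omega> * flow s t \<omega> \<partial>M else 0) \<partial>\<Lambda>) \<in> borel_measurable \<Lambda>"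
        by (rule time.borel_measurable_lebesgue_integral) (unfold split_beta', measurable)
      then show ?thesis by measurable
    qed
  qed
  finally show "(\<integral>x. g (fst x) (snd x) * \<eta> (fst x) (snd x) \<partial>(\<Lambda> \<Otimes>\<^sub>M M))
      = (\<integral>s. v s * (\<integral>t. (if s \<le> t then \<integral>\<omega>. g t \<omega> * flow s t \<omega> \<partial>M else 0) \<partial>\<Lambda>) \<partial>\<Lambda>)" .
qed


lemma measurable_along_state:
  fixes H :: "real \<Rightarrow> real \<Rightarrow> real"
  assumes H: "(\<lambda>(t, x). H t x) \<in> borel_measurable (restrict_space borel ({0..T} \<times> UNIV))"
    and [measurable]: "u \<in> borel_measurable \<Lambda>"
  shows "(\<lambda>x. H (fst x) (state W a z u (fst x) (snd x))) \<in> borel_measurable (\<Lambda> \<Otimes>\<^sub>M M)"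
proof -
  have [measurable]: "fst \<in> borel_measurable (\<Lambda> \<Otimes>\<^sub>M M)"
    by (auto intro: time_measurable)
  have "(\<lambda>x. (fst x, state W a z u (fst x) (snd x)))
      \<in> measurable (\<Lambda> \<Otimes>\<^sub>M M) (restrict_space borel ({0..T} \<times> UNIV))"
    by (rule measurable_restrict_space2) (auto simp: space_pair_measure)
  from measurable_compose[OF this H] show ?thesis by simp
qed

lemma cost_eq:
  assumes "(\<lambda>(t, x). F t x) \<in> borel_measurable (restrict_space borel ({0..T} \<times> UNIV))"
    and "u \<in> borel_measurable \<Lambda>"
  shows "cost M W a z T F u
    = (\<integral>\<^sup>+ x. ennreal (F (fst x) (state W a z u (fst x) (snd x))) \<partial>(\<Lambda> \<Otimes>\<^sub>M M))"
proof -
  have "cost M W a z T F u = (\<integral>\<^sup>+ \<omega>. (\<integral>\<^sup>+ t. ennreal (F t (state W a z u t \<omega>)) \<partial>\<Lambda>) \<partial>M)"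
    unfolding cost_def by (simp add: nn_integral_restrict_space)
  also have "\<dots> = (\<integral>\<^sup>+ x. ennreal (F (fst x) (state W a z u (fst x) (snd x))) \<partial>(\<Lambda> \<Otimes>\<^sub>M M))"
    using time_space.nn_integral_snd[of "\<lambda>x. ennreal (F (fst x) (state W a z u (fst x) (snd x)))"]
      measurable_along_state[OF assms] by simp
  finally show ?thesis .
qed

lemma state_diff:
  assumes \<omega>: "\<omega> \<in> space M" and t: "t \<in> {0..T}"
    and z: "integrable \<Lambda> (\<lambda>s. z s \<omega>)" and u: "integrable \<Lambda> u" and w: "integrable \<Lambda> w"
  shows "state W a z w t \<omega> - state W a z u t \<omega>
    = (\<integral>s. (if s \<le> t then flow s t \<omega> * (u s - w s) else 0) \<partial>\<Lambda>)"
proof -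
  have "integrable \<Lambda> (\<lambda>s. if s \<le> t then flow s t \<omega> * (z s \<omega> - u s) else 0)"
       "integrable \<Lambda> (\<lambda>s. if s \<le> t then flow s t \<omega> * (z s \<omega> - w s) else 0)"
    using z u w by (auto intro!: integrable_flow_mult[OF \<omega> t])
  then have "state W a z w t \<omega> - state W a z u t \<omega>
      = (\<integral>s. (if s \<le> t then flow s t \<omega> * (z s \<omega> - w s) else 0)
          - (if s \<le> t then flow s t \<omega> * (z s \<omega> - u s) else 0) \<partial>\<Lambda>)"
    unfolding state_eq_flow[OF t] by simp
  also have "\<dots> = (\<integral>s. (if s \<le> t then flow s t \<omega> * (u s - w s) else 0) \<partial>\<Lambda>)"
    by (intro Bochner_Integration.integral_cong) (auto simp: algebra_simps)
  finally show ?thesis .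
qed

text \<open>
  The tangent inequality bounds the running cost along \<open>w\<close> by the running cost along \<open>u\<close> plus an
  integrable function \<open>\<phi>\<close>, and the duality together with stationarity makes the integral of \<open>\<phi>\<close>
  vanish. If the cost of \<open>u\<close> is infinite there is nothing to compare; if it is finite, the running
  cost along \<open>u\<close> is integrable and the two terms may be integrated separately.
\<close>

lemma cost_le_if_stationary:
  assumes F_measurable: "(\<lambda>(t, x). F t x) \<in> borel_measurable (restrict_space borel ({0..T} \<times> UNIV))"
    and dF_measurable: "(\<lambda>(t, x). dF t x) \<in> borel_measurable (restrict_space borel ({0..T} \<times> UNIV))"
    and F_nonneg: "\<And>t x. t \<in> {0..T} \<Longrightarrow> F t x \<ge> 0"
    and dF: "\<And>t x. t \<in> {0..T} \<Longrightarrow> (F t has_real_derivative dF t x) (at x)"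
    and F_convex: "\<And>t. t \<in> {0..T} \<Longrightarrow> convex_on UNIV (F t)"
    and \<alpha>: "0 \<le> \<alpha>" "\<alpha> < p"
    and L: "integrable \<Lambda> L" "\<And>t. t \<in> {0..T} \<Longrightarrow> L t \<ge> 0"
    and dF_growth: "\<And>t x. t \<in> {0..T} \<Longrightarrow> \<bar>dF t x\<bar> \<le> L t * (1 + \<bar>x\<bar> powr \<alpha>)"
    and w: "integrable \<Lambda> w" and u: "integrable \<Lambda> u"
    and stationary: "\<And>s. s \<in> {0..T} \<Longrightarrow>
      (\<integral>t. (if s \<le> t then \<integral>\<omega>. dF t (state W a z w t \<omega>) * flow s t \<omega> \<partial>M else 0) \<partial>\<Lambda>) = 0"
  shows "cost M W a z T F w \<le> cost M W a z T F u"
proof (cases "cost M W a z T F u = \<infinity>")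
  case True
  then show ?thesis by simp
next
  case False
  let ?P = "\<Lambda> \<Otimes>\<^sub>M M"
  have um: "u \<in> borel_measurable \<Lambda>" and wm: "w \<in> borel_measurable \<Lambda>"
    using u w by auto
  define Fu where "Fu x = F (fst x) (state W a z u (fst x) (snd x))" for x
  define g where "g t \<omega> = dF t (state W a z w t \<omega>)" for t \<omega>
  define \<eta> where "\<eta> t \<omega> = (\<integral>s. (if s \<le> t then flow s t \<omega> * (u s - w s) else 0) \<partial>\<Lambda>)" for t \<omega>
  define \<phi> where "\<phi> x = g (fst x) (snd x) * \<eta> (fst x) (snd x)" for x
  have g_measurable: "(\<lambda>x. g (fst x) (snd x)) \<in> borel_measurable ?P"
    unfolding g_def by (rule measurable_along_state[OF dF_measurable wm])
  have v: "integrable \<Lambda> (\<lambda>s. u s - w s)"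
    using u w by simp
  have "\<bar>g t \<omega>\<bar> \<le> L t * (1 + \<bar>state W a z w t \<omega>\<bar> powr \<alpha>)" if "t \<in> {0..T}" for t \<omega>
    unfolding g_def by (rule dF_growth[OF that])
  note K = integrable_adjoint_kernel[OF w \<alpha> L g_measurable this v]
  have \<phi>: "integrable ?P \<phi>"
    unfolding \<phi>_def \<eta>_def
    by (rule adjoint_duality(1)[OF borel_measurable_integrable[OF v] g_measurable K])
  have "integral\<^sup>L ?P \<phi> = (\<integral>s. (u s - w s) *
      (\<integral>t. (if s \<le> t then \<integral>\<omega>. g t \<omega> * flow s t \<omega> \<partial>M else 0) \<partial>\<Lambda>) \<partial>\<Lambda>)"
    unfolding \<phi>_def \<eta>_def
    by (rule adjoint_duality(2)[OF borel_measurable_integrable[OF v] g_measurable K])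
  also have "\<dots> = (\<integral>s. 0 \<partial>\<Lambda>)"
    by (intro Bochner_Integration.integral_cong) (auto simp: stationary[folded g_def])
  finally have \<phi>0: "integral\<^sup>L ?P \<phi> = 0"
    by simp
  have tangent: "AE x in ?P. F (fst x) (state W a z w (fst x) (snd x)) \<le> Fu x + \<phi> x"
    using time_space.AE_pair_snd[OF AE_integrable_z] AE_space
  proof eventually_elim
    case (elim x)
    then have t: "fst x \<in> {0..T}" and \<omega>: "snd x \<in> space M"
      by (auto simp: space_pair_measure)
    have "F (fst x) (state W a z u (fst x) (snd x)) - F (fst x) (state W a z w (fst x) (snd x))
        \<ge> dF (fst x) (state W a z w (fst x) (snd x)) *
          (state W a z u (fst x) (snd x) - state W a z w (fst x) (snd x))"
      using dF[OF t] by (intro convex_on_imp_above_tangent[OF F_convex[OF t]]) auto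
    moreover have "state W a z w (fst x) (snd x) - state W a z u (fst x) (snd x) = \<eta> (fst x) (snd x)"
      unfolding \<eta>_def by (rule state_diff[OF \<omega> t elim(1) u w])
    ultimately show ?case
      by (simp add: Fu_def \<phi>_def g_def right_diff_distrib flip: \<open>_ = \<eta> _ _\<close>)
  qed
  from tangent have "cost M W a z T F w \<le> (\<integral>\<^sup>+ x. ennreal (Fu x + \<phi> x) \<partial>?P)"
    unfolding cost_eq[OF F_measurable wm]
    by (intro nn_integral_mono_AE) (auto elim!: eventually_mono intro: ennreal_leI)
  also have "\<dots> \<le> cost M W a z T F u"
  proof -
    have Fu_nonneg: "AE x in ?P. 0 \<le> Fu x"
      using F_nonneg by (intro AE_I2) (auto simp: Fu_def space_pair_measure)
    have sum_nonneg: "AE x in ?P. 0 \<le> Fu x + \<phi> x"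
      using tangent AE_space
    proof eventually_elim
      case (elim x)
      then have "fst x \<in> {0..T}"
        by (auto simp: space_pair_measure)
      from order.trans[OF F_nonneg[OF this] elim(1)] show ?case .
    qed
    have "(\<integral>\<^sup>+ x. ennreal (Fu x) \<partial>?P) < \<infinity>"
      using False unfolding cost_eq[OF F_measurable um] Fu_def by (simp add: less_top)
    then have Fu: "integrable ?P Fu"
      using measurable_along_state[OF F_measurable um] Fu_nonneg
      by (intro integrableI_nonneg) (auto simp: Fu_def[abs_def])
    have "(\<integral>\<^sup>+ x. ennreal (Fu x + \<phi> x) \<partial>?P) = ennreal (\<integral>x. Fu x + \<phi> x \<partial>?P)"
      using Fu \<phi> sum_nonneg by (intro nn_integral_eq_integral) auto
    also have "\<dots> = ennreal (integral\<^sup>L ?P Fu)"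
      using Fu \<phi> \<phi>0 by simp
    also have "\<dots> = (\<integral>\<^sup>+ x. ennreal (Fu x) \<partial>?P)"
      using Fu Fu_nonneg by (intro nn_integral_eq_integral[symmetric])
    also have "\<dots> = cost M W a z T F u"
      unfolding cost_eq[OF F_measurable um] Fu_def ..
    finally show ?thesis by simp
  qed
  finally show ?thesis .
qed

end

theorem theorem4p1:
  fixes M :: "'a measure" and Ft :: "real \<Rightarrow> 'a measure" and W z :: "real \<Rightarrow> 'a \<Rightarrow> real"
    and a L ubar :: "real \<Rightarrow> real" and F dF ddF :: "real \<Rightarrow> real \<Rightarrow> real" and T p \<alpha> :: real
  assumes T: "T > 0"
    and W: "brownian_motion M Ft W"
    and a: "a \<in> Linf T"
    and z_adapted: "\<And>t. t \<in> {0..T} \<Longrightarrow> z t \<in> borel_measurable (Ft t)"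
    and z_measurable: "(\<lambda>(t, \<omega>). z t \<omega>) \<in> borel_measurable (restrict_space borel {0..T} \<Otimes>\<^sub>M M)"
    and p: "p \<ge> 2"
    and z_Lp: "\<And>t. t \<in> {0..T} \<Longrightarrow> integrable M (\<lambda>\<omega>. \<bar>z t \<omega>\<bar> powr p)"
    and z_norm: "set_integrable lebesgue {0..T} (\<lambda>t. (\<integral>\<omega>. \<bar>z t \<omega>\<bar> powr p \<partial>M) powr (2 / p))"
    and F_measurable: "(\<lambda>(t, x). F t x) \<in> borel_measurable (restrict_space borel ({0..T} \<times> UNIV))"
    and F_nonneg: "\<And>t x. t \<in> {0..T} \<Longrightarrow> F t x \<ge> 0"
    and dF: "\<And>t x. t \<in> {0..T} \<Longrightarrow> (F t has_real_derivative dF t x) (at x)"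
    and ddF: "\<And>t x. t \<in> {0..T} \<Longrightarrow> (dF t has_real_derivative ddF t x) (at x)"
    and dF_cont: "continuous_on ({0..T} \<times> UNIV) (\<lambda>(t, x). dF t x)"
    and ddF_cont: "continuous_on ({0..T} \<times> UNIV) (\<lambda>(t, x). ddF t x)"
    and \<alpha>: "0 < \<alpha>" "\<alpha> < p"
    and L: "L \<in> L1 T" "\<And>t. t \<in> {0..T} \<Longrightarrow> L t \<ge> 0"
    and F_growth: "\<And>t x. t \<in> {0..T} \<Longrightarrow>
      \<bar>F t x\<bar> + \<bar>dF t x\<bar> + \<bar>ddF t x\<bar> \<le> L t * (1 + \<bar>x\<bar> powr \<alpha>)"
    and F_convex: "\<And>t. t \<in> {0..T} \<Longrightarrow> convex_on UNIV (F t)"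
    and ubar: "ubar \<in> L1 T"
    and stationary: "\<And>t\<^sub>0. t\<^sub>0 \<in> {0..T} \<Longrightarrow>
      (LINT t:{t\<^sub>0..T}|lebesgue. (\<integral>\<omega>. dF t (state W a z ubar t \<omega>) *
          (geom_bm W t \<omega> / geom_bm W t\<^sub>0 \<omega>) * exp (prim a t - prim a t\<^sub>0) \<partial>M)) = 0"
  shows "is_arg_min (cost M W a z T F) (\<lambda>u. u \<in> L1 T) ubar"
proof -
  interpret controlled_gbm M Ft W T p a z
    using W a z_measurable p z_Lp z_norm by (simp add: controlled_gbm_def controlled_gbm_axioms_def)
  have dF_measurable: "(\<lambda>(t, x). dF t x) \<in> borel_measurable (restrict_space borel ({0..T} \<times> UNIV))"
    using dF_cont by (rule borel_measurable_continuous_on_restrict)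
  have dF_growth: "\<bar>dF t x\<bar> \<le> L t * (1 + \<bar>x\<bar> powr \<alpha>)" if "t \<in> {0..T}" for t x
    using F_growth[OF that, of x] by linarith
  have stationary': "(\<integral>t. (if s \<le> t then \<integral>\<omega>. dF t (state W a z ubar t \<omega>) * flow s t \<omega> \<partial>M else 0) \<partial>\<Lambda>) = 0"
    if s: "s \<in> {0..T}" for s
    using stationary[OF s] set_lebesgue_integral_final_segment[OF s,
      of "\<lambda>t. \<integral>\<omega>. dF t (state W a z ubar t \<omega>) * flow s t \<omega> \<partial>M"]
    by (simp add: flow_def mult.assoc)
  have "cost M W a z T F ubar \<le> cost M W a z T F u" if "u \<in> L1 T" for u
    by (rule cost_le_if_stationary[where dF = dF and \<alpha> = \<alpha> and L = L])
       (use F_measurable dF_measurable F_nonneg dF F_convex \<alpha> L dF_growth ubar that stationary'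
        in \<open>auto simp: L1_iff_integrable\<close>)
  then show ?thesis
    using ubar by (auto simp: is_arg_min_def not_less)
qed

end
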